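(* Consider a group of $Q_g\ge 1$ mutually coherent narrowband signals (the $g$th group) with DOAs $\theta_{g_1},\dots,\theta_{g_{Q_g}}$, distinct modulo $2\pi$, and propagation coefficient vector $\bm\eta_g=[\eta_{g_1},\dots,\eta_{g_{Q_g}}]^T$, impinging on a pair of coprime arrays with coprime parameters $M,N$, with $L_A,L_B$ sensors and subarray sizes $K_A,K_B$, under the standing assumptions given in the context (non-zero coefficients, non-zero source cumulant, non-vanishing signals on both arrays). Let $\bar{\bm\Phi}(g)$ be the generalized spatial smoothed fourth-order cumulant matrix of the group. If $$L_A-K_A+1\ge Q_g\quad\text{and}\quad L_B-K_B+1\ge Q_g,$$ then for every $q\in\{1,\dots,Q_g\}$ the vector $\bm a_0(\theta_{g_q})\otimes \bm b_0^*(\theta_{g_q})$ lies in the signal subspace of $\bar{\bm\Phi}(g)$.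
   Context: Notation: $j=\sqrt{-1}$; $\otimes$ is the Kronecker product; $(\cdot)^*$ is the element-wise complex conjugate; $(\cdot)^H$ is the conjugate transpose; $E\{\cdot\}$ is expectation. Arrays: $M,N$ are coprime positive integers. Array $\mathbb A$ has $L_A$ sensors at positions $M i d$, $i=0,\dots,L_A-1$, and Array $\mathbb B$ has $L_B$ sensors at positions $N i d$, $i=0,\dots,L_B-1$ ($d$ is half a wavelength). The arrays are divided into overlapping subarrays of $K_A$ and $K_B$ consecutive sensors, $1\le K_A\le L_A$, $1\le K_B\le L_B$. For a normalized DOA $\theta$ (a real number, considered modulo $2\pi$), $0\le u\le L_A-K_A$ and $0\le v\le L_B-K_B$, the partial steering vectors are $$\bm a_u(\theta)=[e^{jMu\theta},\dots,e^{jM(u+K_A-1)\theta}]^T,\qquad \bm b_v(\theta)=[e^{jNv\theta},\dots,e^{jN(v+K_B-1)\theta}]^T .$$ Put $\bm A_u(g)=[\bm a_u(\theta_{g_1}),\dots,\bm a_u(\theta_{g_{Q_g}})]$ and $\bm B_v(g)=[\bm b_v(\theta_{g_1}),\dots,\bm b_v(\theta_{g_{Q_g}})]$. Signals: the amplitude vector of the group is $\bm s_g(t)=\bm\eta_g\,\sigma_g(t)$, where $\sigma_g(t)$ is a scalar circularly-symmetric complex random source. Its fourth-order cumulant is $\Psi(\sigma_g)=E\{|\sigma_g(t)|^4\}-2\,(E\{|\sigma_g(t)|^2\})^2$, and the fourth-order cumulant matrix of $\bm s_g$ is $$\bm\Psi(\bm s_g)=(\bm\eta_g\otimes\bm\eta_g^*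 )\,\Psi(\sigma_g)\,(\bm\eta_g\otimes\bm\eta_g^* )^H .$$ Standing assumptions: (i) all entries of $\bm\eta_g$ are non-zero; (ii) $\Psi(\sigma_g)\ne 0$ (source non-Gaussian); (iii) non-vanishing: for every non-empty set $F$ of indices $f\in\{1,\dots,Q_g\}$ such that the DOAs $\theta_{g_f}$, $f\in F$, pairwise differ by integer multiples of $2\pi/M$, one has $\sum_{f\in F}\eta_{g_f}\neq 0$, and likewise with $2\pi/M$ replaced by $2\pi/N$. Fourth-order cumulant matrices: the group matrix on the $(u,v)$ sub-coarrays is $$\bm\Phi_{u,v}(g)=(\bm A_u(g)\otimes\bm B_v^*(g))\,\bm\Psi(\bm s_g)\,(\bm A_u(g)\otimes\bm B_v^*(g))^H ,$$ and the generalized spatial smoothed matrix of the group is $$\bar{\bm\Phi}(g)=\sum_{u=0}^{L_A-K_A}\sum_{v=0}^{L_B-K_B}\bm\Phi_{u,v}(g).$$ The signal subspace of a Hermitian matrix of this kind is the span of its eigenvectors with non-zero eigenvalues, i.e. its column space; the noise subspace is its orthogonal complement. *)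

theory Defs
  imports
    "HOL-Probability.Probability_Measure"
    "Jordan_Normal_Form.Schur_Decomposition"
    "Jordan_Normal_Form.VS_Connect"
begin

no_notation Finite_Cartesian_Product.vec_nth (infixl \<open>$\<close> 90)

definition kron_vec :: "complex Matrix.vec \<Rightarrow> complex Matrix.vec \<Rightarrow> complex Matrix.vec" where
  "kron_vec v w =
    Matrix.vec (dim_vec v * dim_vec w) (\<lambda>i. v $ (i div dim_vec w) * w $ (i mod dim_vec w))"

definition kron_mat :: "complex Matrix.mat \<Rightarrow> complex Matrix.mat \<Rightarrow> complex Matrix.mat" where
  "kron_mat A B = Matrix.mat (dim_row A * dim_row B) (dim_col A * dim_col B)
    (\<lambda>(i, j). A $$ (i div dim_row B, j div dim_col B) * B $$ (i mod dim_row B, j mod dim_col B))"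

(* P is the coprime parameter of the array: positions P * i * d with d half a wavelength,
   which is already absorbed in the normalized DOA. *)
definition steering_vec :: "nat \<Rightarrow> nat \<Rightarrow> nat \<Rightarrow> real \<Rightarrow> complex Matrix.vec" where
  "steering_vec P K u \<theta> = Matrix.vec K (\<lambda>k. cis (real P * real (u + k) * \<theta>))"

definition steering_mat :: "nat \<Rightarrow> nat \<Rightarrow> nat \<Rightarrow> real Matrix.vec \<Rightarrow> complex Matrix.mat" where
  "steering_mat P K u \<theta> = mat_of_cols K (map (steering_vec P K u) (list_of_vec \<theta>))"

definition circularly_symmetric :: "'w measure \<Rightarrow> ('w \<Rightarrow> complex) \<Rightarrow> bool" where
  "circularly_symmetric S \<sigma> \<longleftrightarrow>
    (\<forall>\<phi>. distr S borel (\<lambda>\<omega>. cis \<phi> * \<sigma> \<omega>) = distr S borel \<sigma>)"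

definition cumulant4 :: "'w measure \<Rightarrow> ('w \<Rightarrow> complex) \<Rightarrow> real" where
  "cumulant4 S \<sigma> =
    prob_space.expectation S (\<lambda>\<omega>. cmod (\<sigma> \<omega>) ^ 4)
    - 2 * (prob_space.expectation S (\<lambda>\<omega>. cmod (\<sigma> \<omega>) ^ 2))\<^sup>2"

(* The vector kron_vec \<eta> (conjugate \<eta>) is turned into a one-column matrix. *)
definition cumulant4_mat ::
    "complex Matrix.vec \<Rightarrow> 'w measure \<Rightarrow> ('w \<Rightarrow> complex) \<Rightarrow> complex Matrix.mat" where
  "cumulant4_mat \<eta> S \<sigma> =
    (let w = kron_vec \<eta> (conjugate \<eta>); W = mat_of_cols (dim_vec w) [w]
     in complex_of_real (cumulant4 S \<sigma>) \<cdot>\<^sub>m (W * mat_adjoint W))"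

definition non_vanishing :: "nat \<Rightarrow> real Matrix.vec \<Rightarrow> complex Matrix.vec \<Rightarrow> bool" where
  "non_vanishing P \<theta> \<eta> \<longleftrightarrow>
    (\<forall>F. F \<subseteq> {..<dim_vec \<theta>} \<and> F \<noteq> {} \<and>
         (\<forall>f\<in>F. \<forall>f'\<in>F. \<exists>k::int. \<theta> $ f - \<theta> $ f' = of_int k * (2 * pi / real P))
       \<longrightarrow> (\<Sum>f\<in>F. \<eta> $ f) \<noteq> 0)"

definition group_cumulant_mat ::
    "nat \<Rightarrow> nat \<Rightarrow> nat \<Rightarrow> nat \<Rightarrow> real Matrix.vec \<Rightarrow> complex Matrix.vec
      \<Rightarrow> 'w measure \<Rightarrow> ('w \<Rightarrow> complex) \<Rightarrow> nat \<Rightarrow> nat \<Rightarrow> complex Matrix.mat" where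
  "group_cumulant_mat M N K\<^sub>A K\<^sub>B \<theta> \<eta> S \<sigma> u v =
    (let C = kron_mat (steering_mat M K\<^sub>A u \<theta>) (map_mat cnj (steering_mat N K\<^sub>B v \<theta>))
     in C * cumulant4_mat \<eta> S \<sigma> * mat_adjoint C)"

definition smoothed_cumulant_mat ::
    "nat \<Rightarrow> nat \<Rightarrow> nat \<Rightarrow> nat \<Rightarrow> nat \<Rightarrow> nat \<Rightarrow> real Matrix.vec \<Rightarrow> complex Matrix.vec
      \<Rightarrow> 'w measure \<Rightarrow> ('w \<Rightarrow> complex) \<Rightarrow> complex Matrix.mat" where
  "smoothed_cumulant_mat M N L\<^sub>A L\<^sub>B K\<^sub>A K\<^sub>B \<theta> \<eta> S \<sigma> =
    Matrix.mat (K\<^sub>A * K\<^sub>B) (K\<^sub>A * K\<^sub>B)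
      (\<lambda>ij. \<Sum>u = 0..L\<^sub>A - K\<^sub>A. \<Sum>v = 0..L\<^sub>B - K\<^sub>B.
        group_cumulant_mat M N K\<^sub>A K\<^sub>B \<theta> \<eta> S \<sigma> u v $$ ij)"

definition signal_subspace :: "complex Matrix.mat \<Rightarrow> complex Matrix.vec set" where
  "signal_subspace A =
    LinearCombinations.module.span class_ring (module_vec TYPE(complex) (dim_row A))
      {x. \<exists>k. k \<noteq> 0 \<and> eigenvector A x k}"

end

theory Submission
  imports Defs
begin

text \<open>Let \<open>x\<^sub>u\<close> be the noiseless output of the \<open>u\<close>-th subarray of the first array, \<open>y\<^sub>v\<close> that of the
  \<open>v\<close>-th subarray of the second one. The smoothed matrix is \<open>\<Psi>\<close> times the sum of the rank-one
  matrices of the vectors \<open>x\<^sub>u \<otimes> y\<^sub>v\<^sup>*\<close>, so a kernel vector is orthogonal to all of these (the sign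
  of \<open>\<Psi>\<close> is irrelevant). Since \<open>x\<^sub>u = \<Sum>\<^sub>p \<eta>\<^sub>p z\<^sub>p\<^sup>u a\<^sub>0(\<theta>\<^sub>p)\<close> with \<open>z\<^sub>p = cis (M \<theta>\<^sub>p)\<close>, and \<open>a\<^sub>0(\<theta>\<^sub>p)\<close> depends on
  \<open>z\<^sub>p\<close> only, applying the coefficients of the polynomial of degree less than \<open>Q\<close> that vanishes at
  all \<open>z\<^sub>p \<noteq> z\<^sub>q\<close> isolates \<open>a\<^sub>0(\<theta>\<^sub>q)\<close> times the sum of the coefficients \<open>\<eta>\<^sub>p\<close> with \<open>z\<^sub>p = z\<^sub>q\<close>, which is
  non-zero by the non-vanishing assumption. Hence \<open>a\<^sub>0(\<theta>\<^sub>q) \<otimes> b\<^sub>0\<^sup>*(\<theta>\<^sub>q)\<close> is orthogonal to the kernel, and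
  for a Hermitian matrix the orthogonal complement of the kernel is the signal subspace.\<close>

subsection \<open>Hermitian matrices: the signal subspace is the orthogonal complement of the kernel\<close>

text \<open>The span of all eigenspaces, the kernel included. Each summand may have its own
  eigenvalue \<open>k\<close>, and \<open>x\<close> may be zero, so no side conditions arise in
  inductions; scalars are absorbed into the eigenvectors.\<close>

inductive_set eig_sums :: "complex Matrix.mat \<Rightarrow> complex Matrix.vec set" for A where
  zero: "0\<^sub>v (dim_row A) \<in> eig_sums A"
| add: "x \<in> carrier_vec (dim_row A) \<Longrightarrow> A *\<^sub>v x = k \<cdot>\<^sub>v x \<Longrightarrow> s \<in> eig_sums A \<Longrightarrow> x + s \<in> eig_sums A"

lemma eig_sums_carrier: "s \<in> eig_sums A \<Longrightarrow> s \<in> carrier_vec (dim_row A)"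
  by (induction rule: eig_sums.induct) auto

lemma eig_sums_plus:
  assumes "s \<in> eig_sums A" "t \<in> eig_sums A"
  shows "s + t \<in> eig_sums A"
  using assms(1)
proof (induction rule: eig_sums.induct)
  case zero
  then show ?case using assms(2) eig_sums_carrier[OF assms(2)] by simp
next
  case (add x k s)
  have "x + s + t = x + (s + t)"
    using add.hyps eig_sums_carrier[of s A] eig_sums_carrier[OF assms(2)] by (intro assoc_add_vec) auto
  then show ?case using add eig_sums.add by metis
qed

lemma eig_sums_smult:
  assumes A: "A \<in> carrier_mat n n" and "s \<in> eig_sums A"
  shows "c \<cdot>\<^sub>v s \<in> eig_sums A"
  using assms(2)
proof (induction rule: eig_sums.induct)
  case zero
  have "c \<cdot>\<^sub>v 0\<^sub>v (dim_row A) = 0\<^sub>v (dim_row A)" by auto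
  then show ?case using eig_sums.zero[of A] by simp
next
  case (add x k s)
  have "A *\<^sub>v (c \<cdot>\<^sub>v x) = k \<cdot>\<^sub>v (c \<cdot>\<^sub>v x)"
    using add.hyps A by (simp add: mult_mat_vec[OF A] smult_smult_assoc mult.commute)
  then have "c \<cdot>\<^sub>v x + c \<cdot>\<^sub>v s \<in> eig_sums A"
    using add eig_sums.add by (metis smult_carrier_vec)
  then show ?case using add.hyps eig_sums_carrier[of s A] 
    by (metis smult_add_distrib_vec)
qed

text \<open>Splitting off the component in the eigenspace of \<open>l\<close>: on the other eigenspaces
  \<open>A - l\<close> is invertible.\<close>

lemma eig_sums_split:
  assumes A: "A \<in> carrier_mat n n" and "s \<in> eig_sums A"
  shows "\<exists>r e. r \<in> carrier_vec n \<and> e \<in> eig_sums A \<and> A *\<^sub>v r = l \<cdot>\<^sub>v r \<and> s = r + (A *\<^sub>v e - l \<cdot>\<^sub>v e)"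
  using assms(2)
proof (induction rule: eig_sums.induct)
  case zero
  then show ?case using A eig_sums.zero[of A]
    by (intro exI[of _ "0\<^sub>v n"]) auto
next
  case (add x k s)
  then obtain r e where re: "r \<in> carrier_vec n" "e \<in> eig_sums A" "A *\<^sub>v r = l \<cdot>\<^sub>v r"
    "s = r + (A *\<^sub>v e - l \<cdot>\<^sub>v e)" by blast
  have x: "x \<in> carrier_vec n" using add A by simp
  have e: "e \<in> carrier_vec n" using re(2) eig_sums_carrier A by fastforce
  have Ae: "A *\<^sub>v e \<in> carrier_vec n" using A e by simp
  show ?case
  proof (cases "k = l")
    case True
    have "A *\<^sub>v (x + r) = l \<cdot>\<^sub>v (x + r)"
      using A x re(1,3) add.hyps(2) True by (simp add: mult_add_distrib_mat_vec[OF A] smult_add_distrib_vec)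
    moreover have "x + s = (x + r) + (A *\<^sub>v e - l \<cdot>\<^sub>v e)"
      unfolding re(4) using x re(1) Ae e by auto
    ultimately show ?thesis using x re by (intro exI[of _ "x + r"] exI[of _ e]) auto
  next
    case False
    \<comment> \<open>A preimage of \<open>x\<close> under \<open>A - l\<close>, because
      \<open>A - l\<close> acts on \<open>x\<close> as multiplication by \<open>k - l\<close>, which
      is non-zero here.\<close>
    define e' where "e' = (1 / (k - l)) \<cdot>\<^sub>v x"
    have e': "e' \<in> carrier_vec n" using x e'_def by simp
    have xe': "x $ i = (k - l) * e' $ i" if "i < n" for i
      using that x False by (simp add: e'_def)
    have Ae': "A *\<^sub>v e' = k \<cdot>\<^sub>v e'"
      unfolding e'_def using x A add.hyps(2)
      by (simp add: mult_mat_vec[OF A] smult_smult_assoc mult.commute)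
    have "e' + e \<in> eig_sums A"
      using eig_sums.add[OF _ Ae' re(2)] e' A by simp
    moreover have "x + s = r + (A *\<^sub>v (e' + e) - l \<cdot>\<^sub>v (e' + e))"
    proof -
      have "A *\<^sub>v (e' + e) = k \<cdot>\<^sub>v e' + A *\<^sub>v e"
        using Ae' e' e A by (simp add: mult_add_distrib_mat_vec[OF A])
      moreover have "x + s = r + (k \<cdot>\<^sub>v e' + A *\<^sub>v e - l \<cdot>\<^sub>v (e' + e))"
        unfolding re(4) using x e e' A Ae re(1) xe'
        by (intro eq_vecI) (auto simp del: index_mult_mat_vec simp: algebra_simps)
      ultimately show ?thesis by simp
    qed
    ultimately show ?thesis using re by blast
  qed
qed

text \<open>Applying \<open>A\<close> scales each summand by its eigenvalue, so the kernel part
  disappears and only eigenvectors with non-zero eigenvalue survive.\<close>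

lemma image_eig_sums_in_signal_subspace:
  assumes A: "A \<in> carrier_mat n n" and "s \<in> eig_sums A"
  shows "A *\<^sub>v s \<in> signal_subspace A"
  using assms(2)
proof (induction rule: eig_sums.induct)
  interpret vec_space "TYPE(complex)" n .
  let ?E = "{x. \<exists>k. k \<noteq> 0 \<and> eigenvector A x k}"
  have E: "?E \<subseteq> carrier_vec n" using A by (auto simp: eigenvector_def)
  have sub: "signal_subspace A = span ?E" using A by (simp add: signal_subspace_def)
  have zero_in: "0\<^sub>v n \<in> span ?E" using span_zero E by auto
  {
    case zero
    have "A *\<^sub>v 0\<^sub>v n = 0\<^sub>v n" using A by auto
    then show ?case using A sub zero_in by simp
  next
    case (add x k s)
    have x: "x \<in> carrier_vec n" using add A by simp
    have s: "s \<in> carrier_vec n" using add(3) eig_sums_carrier A by fastforce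
    have "k \<cdot>\<^sub>v x \<in> span ?E"
    \<comment> \<open>\<open>signal_subspace\<close> admits neither the eigenvalue 0 nor the zero
      vector, but in both cases the summand vanishes.\<close>
    proof (cases "k = 0 \<or> x = 0\<^sub>v n")
      case True
      then have "k \<cdot>\<^sub>v x = 0\<^sub>v n" using x by auto
      then show ?thesis using zero_in by simp
    next
      case False
      then have "x \<in> ?E" using x A add.hyps(2) by (auto simp: eigenvector_def)
      then show ?thesis using E in_own_span[OF E] smult_in_span[OF E] by auto
    qed
    then have "k \<cdot>\<^sub>v x + A *\<^sub>v s \<in> span ?E"
      using add.IH sub span_add1[OF E] by simp
    moreover have "A *\<^sub>v (x + s) = k \<cdot>\<^sub>v x + A *\<^sub>v s"
      using x s A add.hyps(2) by (simp add: mult_add_distrib_mat_vec[OF A])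
    ultimately show ?case using sub by simp
  }
qed

section \<open>Diagonalizability of Hermitian matrices\<close>

context
  fixes A :: "complex Matrix.mat" and n :: nat
  assumes A: "A \<in> carrier_mat n n"
    and herm: "\<And>i j. i < n \<Longrightarrow> j < n \<Longrightarrow> A $$ (i, j) = cnj (A $$ (j, i))"
begin

lemma hermitian_cscalar_prod:
  assumes x: "x \<in> carrier_vec n" and y: "y \<in> carrier_vec n"
  shows "(A *\<^sub>v x) \<bullet>c y = x \<bullet>c (A *\<^sub>v y)"
proof -
  have "(A *\<^sub>v x) \<bullet>c y = (\<Sum>i<n. \<Sum>j<n. A $$ (i, j) * x $ j * cnj (y $ i))"
    using A x y by (simp add: scalar_prod_def atLeast0LessThan sum_distrib_right)
  also have "\<dots> = (\<Sum>j<n. \<Sum>i<n. A $$ (i, j) * x $ j * cnj (y $ i))"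
    by (rule sum.swap)
  also have "\<dots> = (\<Sum>j<n. \<Sum>i<n. x $ j * cnj (A $$ (j, i) * y $ i))"
    by (intro sum.cong refl) (subst herm, auto)
  also have "\<dots> = x \<bullet>c (A *\<^sub>v y)"
    using A x y by (simp add: scalar_prod_def atLeast0LessThan sum_distrib_left)
  finally show ?thesis .
qed

text \<open>A Hermitian matrix has no Jordan chain of length two: moving \<open>A - l\<close> across
  the inner product makes \<open>r\<close> orthogonal to itself when \<open>l\<close> is
  real.\<close>

lemma hermitian_eigenvector_not_in_range:
  assumes x: "x \<in> carrier_vec n" and r: "r \<in> carrier_vec n"
    and Ar: "A *\<^sub>v r = l \<cdot>\<^sub>v r" and Ax: "A *\<^sub>v x - l \<cdot>\<^sub>v x = r"
  shows "r = 0\<^sub>v n"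
proof -
  have "l * (r \<bullet>c r) = cnj l * (r \<bullet>c r)"
    using hermitian_cscalar_prod[OF r r] r by (simp add: Ar conjugate_smult_vec)
  moreover have "r \<bullet>c r = (cnj l - l) * (x \<bullet>c r)"
  proof -
    have "r \<bullet>c r = (A *\<^sub>v x - l \<cdot>\<^sub>v x) \<bullet>c r" by (simp add: Ax)
    also have "\<dots> = (A *\<^sub>v x) \<bullet>c r - l * (x \<bullet>c r)"
      using A x r by (simp add: minus_scalar_prod_distrib[of _ n])
    also have "(A *\<^sub>v x) \<bullet>c r = cnj l * (x \<bullet>c r)"
      using hermitian_cscalar_prod[OF x r] x r by (simp add: Ar conjugate_smult_vec)
    finally show ?thesis by (simp add: algebra_simps)
  qed
  \<comment> \<open>For real \<open>l\<close> the second identity has the factor 0; for non-real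
    \<open>l\<close> the first one forces the square of \<open>r\<close> to vanish.\<close>
  ultimately have "r \<bullet>c r = 0" by (cases "cnj l = l") auto
  then show ?thesis using r conjugate_square_eq_0_vec by blast
qed

text \<open>Splitting the image gives \<open>e\<close> such that \<open>A - l\<close> maps
  \<open>s - e\<close> to a vector \<open>r\<close> that it annihilates. Without Jordan chains
  \<open>r\<close> is zero, so \<open>s - e\<close> itself lies in the eigenspace of
  \<open>l\<close>.\<close>

lemma hermitian_eig_sums_preimage:
  assumes s: "s \<in> carrier_vec n" and "A *\<^sub>v s - l \<cdot>\<^sub>v s \<in> eig_sums A"
  shows "s \<in> eig_sums A"
proof -
  from eig_sums_split[OF A assms(2)] obtain r e where re: "r \<in> carrier_vec n" "e \<in> eig_sums A"
    "A *\<^sub>v r = l \<cdot>\<^sub>v r" "A *\<^sub>v s - l \<cdot>\<^sub>v s = r + (A *\<^sub>v e - l \<cdot>\<^sub>v e)" by blast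
  have e: "e \<in> carrier_vec n" using re(2) eig_sums_carrier A by fastforce
  have Ad: "A *\<^sub>v (s - e) = A *\<^sub>v s - A *\<^sub>v e"
    using A s e by (simp add: mult_minus_distrib_mat_vec)
  have "A *\<^sub>v (s - e) - l \<cdot>\<^sub>v (s - e) = r"
  proof (rule eq_vecI)
    fix i assume i: "i < dim_vec r"
    have "(A *\<^sub>v s - l \<cdot>\<^sub>v s) $ i = (r + (A *\<^sub>v e - l \<cdot>\<^sub>v e)) $ i" by (simp add: re(4))
    then show "(A *\<^sub>v (s - e) - l \<cdot>\<^sub>v (s - e)) $ i = r $ i"
      unfolding Ad using i re(1) e s A by (simp del: index_mult_mat_vec add: algebra_simps)
  qed (use re e s A in auto)
  with hermitian_eigenvector_not_in_range[OF _ re(1,3), of "s - e"] s e have r0: "r = 0\<^sub>v n" by simp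
  have "A *\<^sub>v (s - e) = l \<cdot>\<^sub>v (s - e)"
  proof (rule eq_vecI)
    fix i assume i: "i < dim_vec (l \<cdot>\<^sub>v (s - e))"
    have "(A *\<^sub>v (s - e) - l \<cdot>\<^sub>v (s - e)) $ i = (0\<^sub>v n) $ i"
      using \<open>A *\<^sub>v (s - e) - l \<cdot>\<^sub>v (s - e) = r\<close> r0 by simp
    then show "(A *\<^sub>v (s - e)) $ i = (l \<cdot>\<^sub>v (s - e)) $ i"
      using i e s A by (simp del: index_mult_mat_vec)
  qed (use e s A in auto)
  then have "(s - e) + e \<in> eig_sums A" using eig_sums.add[OF _ _ re(2)] s e A by simp
  moreover have "(s - e) + e = s" using s e by auto
  ultimately show ?thesis by simp
qed

lemma eig_sums_lincomb:
  fixes m :: nat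
  assumes "\<And>i. i < m \<Longrightarrow> f i \<in> eig_sums A"
  shows "Matrix.vec n (\<lambda>k. \<Sum>i<m. c i * f i $ k) \<in> eig_sums A"
  using assms
proof (induction m rule: nat_induct)
  case 0
  have "Matrix.vec n (\<lambda>k. \<Sum>i<0. c i * f i $ k) = 0\<^sub>v (dim_row A)" using A by auto
  then show ?case using eig_sums.zero[of A] by simp
next
  case (Suc m)
  have fm: "f m \<in> carrier_vec n" using Suc.prems[of m] eig_sums_carrier A by fastforce
  have "Matrix.vec n (\<lambda>k. \<Sum>i<Suc m. c i * f i $ k)
      = Matrix.vec n (\<lambda>k. \<Sum>i<m. c i * f i $ k) + c m \<cdot>\<^sub>v f m"
    using fm by (intro eq_vecI) auto
  then show ?case using eig_sums_plus[OF Suc.IH eig_sums_smult[OF A Suc.prems[of m]]] Suc.prems by simp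
qed

text \<open>Diagonalizability from Schur triangularization: \<open>A - B $$ (i, i)\<close> maps
  column \<open>i\<close> of \<open>P\<close> into the span of the earlier columns, so by induction
  every column is a sum of eigenvectors; the columns span because \<open>P\<close> is
  invertible.\<close>

lemma hermitian_eig_sums: "carrier_vec n \<subseteq> eig_sums A"
proof
  fix t :: "complex Matrix.vec" assume t: "t \<in> carrier_vec n"
  obtain es where es: "char_poly A = (\<Prod>a\<leftarrow>es. [:- a, 1:])"
    using char_poly_factorized[OF A] by blast
  obtain B P R where "schur_decomposition A es = (B, P, R)"
    by (cases "schur_decomposition A es")
  from schur_decomposition[OF A es this] have wit: "similar_mat_wit A B P R" and ut: "upper_triangular B"
    by auto
  from similar_mat_witD2[OF A wit] have PR: "P * R = 1\<^sub>m n" and RP: "R * P = 1\<^sub>m n"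
    and eq: "A = P * B * R" and car: "B \<in> carrier_mat n n" "P \<in> carrier_mat n n" "R \<in> carrier_mat n n"
    by auto
  have AP: "A * P = P * B"
    unfolding eq using car RP by (simp add: assoc_mult_mat[of _ n n _ n _ n])
  have colP: "col P i \<in> eig_sums A" if "i < n" for i
    using that
  proof (induction i rule: less_induct)
    case (less i)
    have "A *\<^sub>v col P i - B $$ (i, i) \<cdot>\<^sub>v col P i
        = Matrix.vec n (\<lambda>k. \<Sum>j<i. B $$ (j, i) * col P j $ k)"
    proof (rule eq_vecI)
      fix k assume "k < dim_vec (Matrix.vec n (\<lambda>k. \<Sum>j<i. B $$ (j, i) * col P j $ k))"
      then have k: "k < n" by simp
      have "(A *\<^sub>v col P i) $ k = (A * P) $$ (k, i)" using A car k less.prems by simp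
      also have "\<dots> = (\<Sum>j<n. B $$ (j, i) * P $$ (k, j))"
        unfolding AP using car k less.prems by (simp add: scalar_prod_def atLeast0LessThan mult.commute)
      \<comment> \<open>Entries of \<open>B\<close> below the diagonal are zero; the term
        \<open>j = i\<close> that remains is the one subtracted on the left-hand side.\<close>
      also have "\<dots> = (\<Sum>j<Suc i. B $$ (j, i) * P $$ (k, j))"
        using less.prems ut car by (intro sum.mono_neutral_right) (auto simp: upper_triangular_def)
      finally show "(A *\<^sub>v col P i - B $$ (i, i) \<cdot>\<^sub>v col P i) $ k
          = Matrix.vec n (\<lambda>k. \<Sum>j<i. B $$ (j, i) * col P j $ k) $ k"
        using k less.prems car A by (simp del: index_mult_mat_vec)
    qed (use car A in auto)
    moreover have "Matrix.vec n (\<lambda>k. \<Sum>j<i. B $$ (j, i) * col P j $ k) \<in> eig_sums A"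
    proof (rule eig_sums_lincomb)
      fix j assume "j < i"
      then show "col P j \<in> eig_sums A" using less.IH[of j] less.prems by linarith
    qed
    ultimately have diff: "A *\<^sub>v col P i - B $$ (i, i) \<cdot>\<^sub>v col P i \<in> eig_sums A"
      by (rule ssubst)
    have "col P i \<in> carrier_vec n" using car(2) by (rule col_carrier_vec[OF less.prems])
    from hermitian_eig_sums_preimage[OF this diff] show ?case .
  qed
  define y where "y = R *\<^sub>v t"
  have y: "y \<in> carrier_vec n" using car t by (simp add: y_def)
  have "t = P *\<^sub>v y"
    using assoc_mult_mat_vec[OF car(2,3) t] t unfolding PR y_def by simp
  also have "\<dots> = Matrix.vec n (\<lambda>k. \<Sum>i<n. y $ i * col P i $ k)"
  proof (rule eq_vecI)
    fix k assume "k < dim_vec (Matrix.vec n (\<lambda>k. \<Sum>i<n. y $ i * col P i $ k))"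
    then show "(P *\<^sub>v y) $ k = Matrix.vec n (\<lambda>k. \<Sum>i<n. y $ i * col P i $ k) $ k"
      using car y by (simp add: scalar_prod_def atLeast0LessThan mult.commute)
  qed (use car in simp)
  also have "\<dots> \<in> eig_sums A" by (rule eig_sums_lincomb[of n "\<lambda>j. col P j"]) (rule colP)
  finally show "t \<in> eig_sums A" .
qed

text \<open>Splitting at eigenvalue 0 gives \<open>t = r + A *\<^sub>v e\<close> with
  \<open>r\<close> in the kernel. Both \<open>t\<close> and \<open>A *\<^sub>v e\<close> are
  orthogonal to \<open>r\<close>, hence \<open>r\<close> is zero and \<open>t\<close> is an
  image.\<close>

lemma hermitian_orthogonal_kernel_in_signal_subspace:
  assumes t: "t \<in> carrier_vec n"
    and orth: "\<And>x. x \<in> carrier_vec n \<Longrightarrow> A *\<^sub>v x = 0\<^sub>v n \<Longrightarrow> t \<bullet>c x = 0"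
  shows "t \<in> signal_subspace A"
proof -
  obtain r e where re: "r \<in> carrier_vec n" "e \<in> eig_sums A"
    "A *\<^sub>v r = 0 \<cdot>\<^sub>v r" "t = r + (A *\<^sub>v e - 0 \<cdot>\<^sub>v e)"
    using eig_sums_split[OF A, of t 0] hermitian_eig_sums t by blast
  have e: "e \<in> carrier_vec n" using re(2) eig_sums_carrier A by fastforce
  have teq: "t = r + A *\<^sub>v e" using re e A by auto
  have Ar: "A *\<^sub>v r = 0\<^sub>v n" using re by auto
  have "0 = (r + A *\<^sub>v e) \<bullet>c r" using orth[OF re(1) Ar] teq by simp
  also have "\<dots> = r \<bullet>c r + (A *\<^sub>v e) \<bullet>c r"
    using re(1) e A by (intro add_scalar_prod_distrib[of _ n]) auto
  also have "(A *\<^sub>v e) \<bullet>c r = 0"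
    using hermitian_cscalar_prod[OF e re(1)] e Ar by simp
  finally have "r = 0\<^sub>v n" using re(1) conjugate_square_eq_0_vec by auto
  then have "t = A *\<^sub>v e" using teq e A by auto
  then show ?thesis using image_eig_sums_in_signal_subspace[OF A re(2)] by simp
qed

end

subsection \<open>Separating coherent exponentials\<close>

text \<open>The nodes \<open>z p\<close> may coincide, so only the total coefficient at the node
  \<open>z q\<close> can be isolated. One choice of \<open>c\<close> serves all shifts
  \<open>k\<close>, which later recovers a whole steering vector at once.\<close>

lemma extract_exponential:
  fixes z \<eta> :: "nat \<Rightarrow> complex"
  assumes q: "q < Q" and D: "Q \<le> Suc D"
    and nz: "(\<Sum>p\<in>{p\<in>{..<Q}. z p = z q}. \<eta> p) \<noteq> 0"
  shows "\<exists>c. \<forall>k. (\<Sum>u\<le>D. c u * (\<Sum>p<Q. \<eta> p * z p ^ (u + k))) = z q ^ k"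
proof -
  define Z where "Z = z ` {..<Q} - {z q}"
  define h where "h = (\<Sum>p\<in>{p\<in>{..<Q}. z p = z q}. \<eta> p)"
  have h0: "h \<noteq> 0" using nz unfolding h_def .
  define f where "f = (\<Prod>x\<in>Z. [:- x, 1:])"
  have fin: "finite Z" by (simp add: Z_def)
  \<comment> \<open>Removing the node \<open>z q\<close> leaves at most \<open>Q - 1\<close> roots,
    just enough for the degree to be at most \<open>D\<close>.\<close>
  have "card Z < Q"
    using q card_image_le[of "{..<Q}" z] card_Diff1_less[of "z ` {..<Q}" "z q"] by (auto simp: Z_def)
  moreover have "degree f \<le> (\<Sum>x\<in>Z. 1)"
    unfolding f_def using degree_prod_sum_le[OF fin, of "\<lambda>x. [:- x, 1:]"] by simp
  ultimately have deg: "degree f \<le> D" using D by simp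
  have root: "poly f (z p) = 0" if "p < Q" "z p \<noteq> z q" for p
    using that fin by (auto simp: f_def poly_prod Z_def)
  have nonroot: "poly f (z q) \<noteq> 0"
    using fin by (auto simp: f_def poly_prod Z_def)
  \<comment> \<open>Coefficients of the Lagrange polynomial with value 1 at \<open>z q\<close>,
    divided further by the total coefficient \<open>h\<close> of that node.\<close>
  define c where "c u = coeff f u / (h * poly f (z q))" for u
  have eval: "(\<Sum>u\<le>D. c u * x ^ u) = poly f x / (h * poly f (z q))" for x
    using deg by (simp add: c_def poly_altdef sum_divide_distrib)
       (intro sum.mono_neutral_right; auto simp: coeff_eq_0)
  have "(\<Sum>u\<le>D. c u * (\<Sum>p<Q. \<eta> p * z p ^ (u + k))) = z q ^ k" for k
  proof -
    have "(\<Sum>u\<le>D. c u * (\<Sum>p<Q. \<eta> p * z p ^ (u + k)))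
        = (\<Sum>p<Q. \<Sum>u\<le>D. \<eta> p * z p ^ k * (c u * z p ^ u))"
      unfolding sum_distrib_left by (subst sum.swap) (simp add: power_add mult_ac)
    also have "\<dots> = (\<Sum>p<Q. \<eta> p * z p ^ k * (poly f (z p) / (h * poly f (z q))))"
      by (simp add: sum_distrib_left[symmetric] eval)
    also have "\<dots> = (\<Sum>p\<in>{p\<in>{..<Q}. z p = z q}. \<eta> p * (z q ^ k / h))"
      by (rule sum.mono_neutral_cong_right) (use root nonroot in auto)
    also have "\<dots> = z q ^ k"
      using h0 unfolding sum_distrib_right[symmetric] h_def[symmetric] by simp
    finally show ?thesis .
  qed
  then show ?thesis by blast
qed

text \<open>Translates coincidence of nodes into the congruence used by
  \<open>non_vanishing\<close>; the period of \<open>cis\<close> is divided by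
  \<open>P\<close>.\<close>

lemma cis_eq_imp_diff:
  assumes "P > 0" "cis (real P * a) = cis (real P * b)"
  shows "\<exists>k::int. a - b = of_int k * (2 * pi / real P)"
proof -
  have "exp (\<i> * complex_of_real (real P * a)) = exp (\<i> * complex_of_real (real P * b))"
    using assms(2) by (simp add: cis_conv_exp)
  then obtain k :: int where "\<i> * complex_of_real (real P * a) = \<i> * complex_of_real (real P * b) + (of_int (2 * k) * pi) * \<i>"
    unfolding exp_eq by blast
  then have "\<i> * complex_of_real (real P * a) = \<i> * complex_of_real (real P * b + of_int (2 * k) * pi)"
    by (simp add: algebra_simps)
  then have "real P * a = real P * b + of_int (2 * k) * pi" 
    by (metis complex_i_not_zero mult_left_cancel of_real_eq_iff)
  then have "a - b = of_int k * (2 * pi / real P)" using assms(1) by (simp add: field_simps)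
  then show ?thesis by blast
qed

lemma non_vanishing_extract:
  assumes "P > 0" "non_vanishing P \<theta> \<eta>" "\<theta> \<in> carrier_vec Q" "q < Q" "Q \<le> Suc D"
  shows "\<exists>c. \<forall>k. (\<Sum>u\<le>D. c u * (\<Sum>p<Q. \<eta> $ p * cis (real P * real (u + k) * \<theta> $ p)))
    = cis (real P * real k * \<theta> $ q)"
proof -
  define z where "z p = cis (real P * \<theta> $ p)" for p
  have z: "z p ^ m = cis (real P * real m * \<theta> $ p)" for p m
    by (simp add: z_def Complex.DeMoivre mult_ac)
  \<comment> \<open>The indices sharing the node of \<open>q\<close> form an admissible set
    \<open>F\<close>, non-empty because it contains \<open>q\<close>.\<close>
  have "(\<Sum>p\<in>{p\<in>{..<Q}. z p = z q}. \<eta> $ p) \<noteq> 0"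
    using assms(2)[unfolded non_vanishing_def, rule_format, of "{p\<in>{..<Q}. z p = z q}"]
      cis_eq_imp_diff[OF assms(1)] assms(3,4) by (fastforce simp: z_def)
  from extract_exponential[OF assms(4,5) this] show ?thesis by (simp add: z)
qed

text \<open>Quotient and remainder by \<open>n\<close> enumerate all index pairs, as in a Kronecker
  product, so the sum factors.\<close>

lemma sum_div_mod:
  fixes f g :: "nat \<Rightarrow> 'a :: comm_semiring_0"
  shows "(\<Sum>j<m * n. f (j div n) * g (j mod n)) = (\<Sum>i<m. f i) * (\<Sum>i<n. g i)"
proof -
  have "(\<Sum>j<m * n. f (j div n) * g (j mod n)) = (\<Sum>i<m. \<Sum>j = i * n..<i * n + n. f (j div n) * g (j mod n))"
    by (simp add: sum.nat_group)
  also have "\<dots> = (\<Sum>i<m. \<Sum>j<n. f i * g j)"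
  proof (rule sum.cong[OF refl])
    fix i
    have "(\<Sum>j = 0 + i * n..<n + i * n. f (j div n) * g (j mod n))
        = (\<Sum>j = 0..<n. f ((j + i * n) div n) * g ((j + i * n) mod n))"
      by (rule sum.shift_bounds_nat_ivl)
    also have "\<dots> = (\<Sum>j = 0..<n. f i * g j)" by (intro sum.cong) auto
    finally show "(\<Sum>j = i * n..<i * n + n. f (j div n) * g (j mod n)) = (\<Sum>j<n. f i * g j)"
      by (simp add: add.commute atLeast0LessThan)
  qed
  finally show ?thesis by (simp add: sum_product)
qed

subsection \<open>Entries of the smoothed cumulant matrix\<close>

lemma lincomb_in_signal_subspace_of_rank_one_sum:
  fixes X :: "'i \<Rightarrow> nat \<Rightarrow> complex" and c :: real
  assumes A: "A \<in> carrier_mat n n"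
    and entries: "\<And>i j. i < n \<Longrightarrow> j < n \<Longrightarrow> A $$ (i, j) = c * (\<Sum>l\<in>I. X l i * cnj (X l j))"
    and c: "c \<noteq> 0" and I: "finite I"
    and t: "t \<in> carrier_vec n" and lincomb: "\<And>i. i < n \<Longrightarrow> t $ i = (\<Sum>l\<in>I. d l * X l i)"
  shows "t \<in> signal_subspace A"
proof (rule hermitian_orthogonal_kernel_in_signal_subspace[OF A _ t])
  show "A $$ (i, j) = cnj (A $$ (j, i))" if "i < n" "j < n" for i j
    using that by (simp add: entries mult.commute)
next
  fix x assume x: "x \<in> carrier_vec n" and Ax: "A *\<^sub>v x = 0\<^sub>v n"
  define y where "y l = (\<Sum>i<n. X l i * cnj (x $ i))" for l
  have Ai: "(\<Sum>j<n. A $$ (i, j) * x $ j) = 0" if "i < n" for i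
  proof -
    have "(\<Sum>j<n. A $$ (i, j) * x $ j) = (A *\<^sub>v x) $ i"
      using A x that by (simp add: scalar_prod_def atLeast0LessThan)
    then show ?thesis using that by (simp add: Ax)
  qed
  \<comment> \<open>This is the quadratic form of \<open>A\<close> at the kernel vector
    \<open>x\<close>, hence zero; as \<open>c\<close> is non-zero, a sum of squares vanishes and so
    does each \<open>y l\<close>.\<close>
  have "complex_of_real (c * (\<Sum>l\<in>I. (cmod (y l))\<^sup>2)) = (\<Sum>l\<in>I. c * (y l * cnj (y l)))"
    by (simp add: complex_norm_square[symmetric] sum_distrib_left del: of_real_power)
  also have "\<dots> = (\<Sum>l\<in>I. \<Sum>i<n. \<Sum>j<n. c * (X l i * cnj (x $ i) * (cnj (X l j) * x $ j)))"
    unfolding y_def cnj_sum sum_product unfolding sum_distrib_left by simp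
  also have "\<dots> = (\<Sum>i<n. \<Sum>j<n. \<Sum>l\<in>I. c * (X l i * cnj (x $ i) * (cnj (X l j) * x $ j)))"
    by (subst sum.swap) (intro sum.cong refl sum.swap)
  also have "\<dots> = (\<Sum>i<n. cnj (x $ i) * (\<Sum>j<n. A $$ (i, j) * x $ j))"
    by (simp add: entries sum_distrib_left sum_distrib_right mult_ac)
  also have "\<dots> = 0" by (simp add: Ai)
  finally have "(\<Sum>l\<in>I. (cmod (y l))\<^sup>2) = 0" using c by (simp only: of_real_eq_0_iff mult_eq_0_iff) simp
  then have y0: "y l = 0" if "l \<in> I" for l
    using that I by (simp add: sum_nonneg_eq_0_iff)
  have "t \<bullet>c x = (\<Sum>i<n. \<Sum>l\<in>I. d l * (X l i * cnj (x $ i)))"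
    using x t by (simp add: scalar_prod_def atLeast0LessThan lincomb sum_distrib_left mult_ac)
  also have "\<dots> = (\<Sum>l\<in>I. d l * y l)"
    unfolding y_def sum_distrib_left by (rule sum.swap)
  also have "\<dots> = 0" by (simp add: y0)
  finally show "t \<bullet>c x = 0" .
qed

section \<open>Rank-one form of the group cumulant matrices\<close>

lemma mat_adjoint_dim [simp]:
  "dim_row (mat_adjoint A) = dim_col A" "dim_col (mat_adjoint A) = dim_row A"
  by (simp_all add: mat_adjoint_def)

lemma mat_adjoint_index [simp]:
  "i < dim_col A \<Longrightarrow> j < dim_row A \<Longrightarrow> mat_adjoint A $$ (i, j) = conjugate (A $$ (j, i))"
  by (simp add: mat_adjoint_def mat_of_rows_index)

lemma sandwich_rank_one_index:
  fixes C :: "complex Matrix.mat" and w :: "complex Matrix.vec"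
  assumes C: "C \<in> carrier_mat m n" and w: "w \<in> carrier_vec n" and ij: "i < m" "j < m"
  defines "W \<equiv> mat_of_cols n [w]"
  shows "(C * (c \<cdot>\<^sub>m (W * mat_adjoint W)) * mat_adjoint C) $$ (i, j)
    = c * ((C *\<^sub>v w) $ i * cnj ((C *\<^sub>v w) $ j))"
proof -
  define G where "G = c \<cdot>\<^sub>m (W * mat_adjoint W)"
  have G: "G \<in> carrier_mat n n" unfolding G_def W_def by (intro smult_carrier_mat mult_carrier_mat[of _ _ 1]) auto
  have Gab: "G $$ (a, b) = c * (w $ a * cnj (w $ b))" if "a < n" "b < n" for a b
    using that by (simp add: G_def W_def scalar_prod_def mat_of_cols_index)
  have "(C * G * mat_adjoint C) $$ (i, j)
      = (\<Sum>b<n. (\<Sum>a<n. C $$ (i, a) * G $$ (a, b)) * cnj (C $$ (j, b)))"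
    using C G ij by (simp add: scalar_prod_def atLeast0LessThan)
  also have "\<dots> = (\<Sum>b<n. \<Sum>a<n. c * (C $$ (i, a) * w $ a * cnj (C $$ (j, b) * w $ b)))"
    by (simp add: Gab sum_distrib_left mult_ac)
  also have "\<dots> = c * ((\<Sum>a<n. C $$ (i, a) * w $ a) * cnj (\<Sum>b<n. C $$ (j, b) * w $ b))"
    unfolding cnj_sum sum_product unfolding sum_distrib_left by (rule sum.swap)
  also have "\<dots> = c * ((C *\<^sub>v w) $ i * cnj ((C *\<^sub>v w) $ j))"
    using C w ij by (simp add: scalar_prod_def atLeast0LessThan)
  finally show ?thesis by (simp add: G_def)
qed

text \<open>Noiseless output of sensor \<open>m\<close> for a unit source. Every subarray reads a
  shifted window of this one sequence.\<close>

definition array_output :: "nat \<Rightarrow> real Matrix.vec \<Rightarrow> complex Matrix.vec \<Rightarrow> nat \<Rightarrow> complex" where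
  "array_output P \<theta> \<eta> m = (\<Sum>p<dim_vec \<theta>. \<eta> $ p * cis (real P * real m * \<theta> $ p))"

lemma steering_mat_dim [simp]:
  "dim_row (steering_mat P K u \<theta>) = K" "dim_col (steering_mat P K u \<theta>) = dim_vec \<theta>"
  by (simp_all add: steering_mat_def)

lemma steering_mat_index [simp]:
  "k < K \<Longrightarrow> p < dim_vec \<theta> \<Longrightarrow>
    steering_mat P K u \<theta> $$ (k, p) = cis (real P * real (u + k) * \<theta> $ p)"
  by (simp add: steering_mat_def mat_of_cols_index steering_vec_def list_of_vec_index)

text \<open>The mixed-product rule for Kronecker products, read off entrywise: each factor becomes
  the output of one subarray.\<close>

lemma kron_steering_mult_index:
  assumes \<eta>: "\<eta> \<in> carrier_vec (dim_vec \<theta>)" and i: "i < K * L"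
  shows "(kron_mat (steering_mat M K u \<theta>) (map_mat cnj (steering_mat N L v \<theta>))
      *\<^sub>v kron_vec \<eta> (conjugate \<eta>)) $ i
    = array_output M \<theta> \<eta> (u + i div L) * cnj (array_output N \<theta> \<eta> (v + i mod L))"
proof -
  let ?Q = "dim_vec \<theta>"
  have "L > 0" using i by (cases L) auto
  then have L: "i div L < K" "i mod L < L" using less_mult_imp_div_less[OF i] by simp_all
  have Q: "a div ?Q < ?Q" "a mod ?Q < ?Q" if "a < ?Q * ?Q" for a
  proof -
    show "a div ?Q < ?Q" using that by (rule less_mult_imp_div_less)
    have "?Q > 0" using that by (rule contrapos_pp) simp
    then show "a mod ?Q < ?Q" by (rule mod_less_divisor)
  qed
  let ?f = "\<lambda>p. \<eta> $ p * cis (real M * real (u + i div L) * \<theta> $ p)"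
  let ?g = "\<lambda>p. cnj (\<eta> $ p * cis (real N * real (v + i mod L) * \<theta> $ p))"
  let ?C = "kron_mat (steering_mat M K u \<theta>) (map_mat cnj (steering_mat N L v \<theta>))"
  let ?w = "kron_vec \<eta> (conjugate \<eta>)"
  have dims: "dim_row ?C = K * L" "dim_col ?C = ?Q * ?Q" "dim_vec ?w = ?Q * ?Q"
    using \<eta> by (simp_all add: kron_mat_def kron_vec_def)
  have "(?C *\<^sub>v ?w) $ i = (\<Sum>a<?Q * ?Q. ?C $$ (i, a) * ?w $ a)"
    using i by (simp add: dims scalar_prod_def atLeast0LessThan)
  also have "\<dots> = (\<Sum>a<?Q * ?Q. ?f (a div ?Q) * ?g (a mod ?Q))"
  proof (rule sum.cong[OF refl])
    fix a assume "a \<in> {..<?Q * ?Q}"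
    then have a: "a < ?Q * ?Q" by simp
    have "?C $$ (i, a) = cis (real M * real (u + i div L) * \<theta> $ (a div ?Q))
        * cnj (cis (real N * real (v + i mod L) * \<theta> $ (a mod ?Q)))"
      using i a L Q[OF a] by (simp add: kron_mat_def)
    moreover have "?w $ a = \<eta> $ (a div ?Q) * cnj (\<eta> $ (a mod ?Q))"
      using \<eta> a Q[OF a] by (simp add: kron_vec_def)
    ultimately show "?C $$ (i, a) * ?w $ a = ?f (a div ?Q) * ?g (a mod ?Q)" by simp
  qed
  also have "\<dots> = (\<Sum>p<?Q. ?f p) * (\<Sum>p<?Q. ?g p)" by (rule sum_div_mod)
  finally show ?thesis by (simp add: array_output_def)
qed

lemma group_cumulant_mat_index:
  assumes \<eta>: "\<eta> \<in> carrier_vec (dim_vec \<theta>)" and ij: "i < K * L" "j < K * L"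
  shows "group_cumulant_mat M N K L \<theta> \<eta> S \<sigma> u v $$ (i, j) = cumulant4 S \<sigma> *
    (array_output M \<theta> \<eta> (u + i div L) * cnj (array_output N \<theta> \<eta> (v + i mod L)) *
     cnj (array_output M \<theta> \<eta> (u + j div L) * cnj (array_output N \<theta> \<eta> (v + j mod L))))"
proof -
  let ?C = "kron_mat (steering_mat M K u \<theta>) (map_mat cnj (steering_mat N L v \<theta>))"
  let ?w = "kron_vec \<eta> (conjugate \<eta>)"
  have w: "?w \<in> carrier_vec (dim_vec \<theta> * dim_vec \<theta>)"
    using \<eta> by (auto simp: kron_vec_def)
  have C: "?C \<in> carrier_mat (K * L) (dim_vec \<theta> * dim_vec \<theta>)"
    by (intro carrier_matI) (simp_all add: kron_mat_def)
  have dw: "dim_vec ?w = dim_vec \<theta> * dim_vec \<theta>" using w by simp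
  show ?thesis
    using sandwich_rank_one_index[OF C w ij, of "cumulant4 S \<sigma>"]
    unfolding group_cumulant_mat_def cumulant4_mat_def Let_def dw
      kron_steering_mult_index[OF \<eta> ij(1)] kron_steering_mult_index[OF \<eta> ij(2)] .
qed

section \<open>Combining the two arrays\<close>

theorem theorem1:
  fixes M N L\<^sub>A L\<^sub>B K\<^sub>A K\<^sub>B Q :: nat
    and \<theta> :: "real Matrix.vec"
    and \<eta> :: "complex Matrix.vec"
    and S :: "'w measure"
    and \<sigma> :: "'w \<Rightarrow> complex"
  assumes "M > 0" and "N > 0" and "coprime M N"
    and "1 \<le> K\<^sub>A" and "K\<^sub>A \<le> L\<^sub>A" and "1 \<le> K\<^sub>B" and "K\<^sub>B \<le> L\<^sub>B"
    and "Q \<ge> 1" and "\<theta> \<in> carrier_vec Q" and "\<eta> \<in> carrier_vec Q"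
    and "\<And>p q k. p < Q \<Longrightarrow> q < Q \<Longrightarrow> p \<noteq> q \<Longrightarrow> \<theta> $ p - \<theta> $ q \<noteq> of_int k * (2 * pi)"
    and "prob_space S" and "\<sigma> \<in> borel_measurable S"
    and "integrable S (\<lambda>\<omega>. cmod (\<sigma> \<omega>) ^ 4)"
    and "circularly_symmetric S \<sigma>"
    and "\<And>q. q < Q \<Longrightarrow> \<eta> $ q \<noteq> 0"
    and "cumulant4 S \<sigma> \<noteq> 0"
    and "non_vanishing M \<theta> \<eta>" and "non_vanishing N \<theta> \<eta>"
    and "L\<^sub>A - K\<^sub>A + 1 \<ge> Q" and "L\<^sub>B - K\<^sub>B + 1 \<ge> Q"
  shows "\<forall>q<Q. kron_vec (steering_vec M K\<^sub>A 0 (\<theta> $ q)) (conjugate (steering_vec N K\<^sub>B 0 (\<theta> $ q)))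
    \<in> signal_subspace (smoothed_cumulant_mat M N L\<^sub>A L\<^sub>B K\<^sub>A K\<^sub>B \<theta> \<eta> S \<sigma>)"
proof (intro allI impI)
  fix q assume q: "q < Q"
  let ?I = "{..L\<^sub>A - K\<^sub>A} \<times> {..L\<^sub>B - K\<^sub>B}"
  let ?X = "\<lambda>(u, v) i. array_output M \<theta> \<eta> (u + i div K\<^sub>B) * cnj (array_output N \<theta> \<eta> (v + i mod K\<^sub>B))"
  let ?t = "kron_vec (steering_vec M K\<^sub>A 0 (\<theta> $ q)) (conjugate (steering_vec N K\<^sub>B 0 (\<theta> $ q)))"
  note \<theta> = \<open>\<theta> \<in> carrier_vec Q\<close>
  have \<eta>: "\<eta> \<in> carrier_vec (dim_vec \<theta>)" using \<open>\<eta> \<in> carrier_vec Q\<close> \<theta> by auto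
  \<comment> \<open>There are \<open>L\<^sub>A - K\<^sub>A + 1\<close> shifts, so the degree bound
    is \<open>L\<^sub>A - K\<^sub>A\<close>; the weights do not depend on \<open>k\<close>.\<close>
  obtain a where a: "(\<Sum>u\<le>L\<^sub>A - K\<^sub>A. a u * array_output M \<theta> \<eta> (u + k)) = cis (real M * real k * \<theta> $ q)" for k
    using non_vanishing_extract[OF \<open>M > 0\<close> \<open>non_vanishing M \<theta> \<eta>\<close> \<theta> q, of "L\<^sub>A - K\<^sub>A"]
      \<open>L\<^sub>A - K\<^sub>A + 1 \<ge> Q\<close> \<theta> by (auto simp: array_output_def)
  obtain b where b: "(\<Sum>v\<le>L\<^sub>B - K\<^sub>B. b v * array_output N \<theta> \<eta> (v + k)) = cis (real N * real k * \<theta> $ q)" for k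
    using non_vanishing_extract[OF \<open>N > 0\<close> \<open>non_vanishing N \<theta> \<eta>\<close> \<theta> q, of "L\<^sub>B - K\<^sub>B"]
      \<open>L\<^sub>B - K\<^sub>B + 1 \<ge> Q\<close> \<theta> by (auto simp: array_output_def)
  show "?t \<in> signal_subspace (smoothed_cumulant_mat M N L\<^sub>A L\<^sub>B K\<^sub>A K\<^sub>B \<theta> \<eta> S \<sigma>)"
  proof (rule lincomb_in_signal_subspace_of_rank_one_sum)
    show "smoothed_cumulant_mat M N L\<^sub>A L\<^sub>B K\<^sub>A K\<^sub>B \<theta> \<eta> S \<sigma> \<in> carrier_mat (K\<^sub>A * K\<^sub>B) (K\<^sub>A * K\<^sub>B)"
      by (simp add: smoothed_cumulant_mat_def)
    show "smoothed_cumulant_mat M N L\<^sub>A L\<^sub>B K\<^sub>A K\<^sub>B \<theta> \<eta> S \<sigma> $$ (i, j)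
        = cumulant4 S \<sigma> * (\<Sum>l\<in>?I. ?X l i * cnj (?X l j))"
      if "i < K\<^sub>A * K\<^sub>B" "j < K\<^sub>A * K\<^sub>B" for i j
      using that by (simp add: smoothed_cumulant_mat_def group_cumulant_mat_index[OF \<eta>]
          sum.cartesian_product' atLeast0AtMost sum_distrib_left)
    show "cumulant4 S \<sigma> \<noteq> 0" by fact
    show "finite ?I" by simp
    show "?t \<in> carrier_vec (K\<^sub>A * K\<^sub>B)" by (intro carrier_vecI) (simp add: kron_vec_def steering_vec_def)
    \<comment> \<open>The product of the weights of the two arrays; \<open>b\<close> is conjugated
      because the second factor of \<open>?t\<close> is.\<close>
    show "?t $ i = (\<Sum>l\<in>?I. (case l of (u, v) \<Rightarrow> a u * cnj (b v)) * ?X l i)"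
      if i: "i < K\<^sub>A * K\<^sub>B" for i
    proof -
      have ik: "i div K\<^sub>B < K\<^sub>A" "i mod K\<^sub>B < K\<^sub>B"
        using i \<open>1 \<le> K\<^sub>B\<close> by (auto simp: less_mult_imp_div_less)
      have "?t $ i = cis (real M * real (i div K\<^sub>B) * \<theta> $ q) * cnj (cis (real N * real (i mod K\<^sub>B) * \<theta> $ q))"
        using i ik by (simp add: kron_vec_def steering_vec_def)
      also have "\<dots> = (\<Sum>u\<le>L\<^sub>A - K\<^sub>A. \<Sum>v\<le>L\<^sub>B - K\<^sub>B. a u * cnj (b v) * ?X (u, v) i)"
        unfolding a[symmetric] b[symmetric] cnj_sum sum_product by (simp add: mult_ac)
      finally show ?thesis by (simp add: sum.cartesian_product')
    qed
  qed
qed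

end
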